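(* Let $\mathcal{G}=\{\mathcal{N},\mathcal{L},\boldsymbol{w}\}$ be a connected grid whose line reactances $x_l$ ($l\in\mathcal{L}$) are independent (not necessarily identically distributed) continuous random variables strictly bounded away from zero from below. Let $\mathcal{M}\subseteq\mathcal{N}$, $\mathcal{M}\neq\emptyset$, be the set of PMU buses and $\mathcal{U}\subseteq\mathcal{N}$ the set of unalterable buses. Then, with probability one, the minimum sparsity of unobservable attacks, i.e. the global optimum of $$\min_{\Delta\boldsymbol{\theta}\in\mathbb{R}^N}\ \|\Delta\boldsymbol{P}\|_0\quad\text{s.t.}\quad \Delta\boldsymbol{P}=\boldsymbol{B}\Delta\boldsymbol{\theta},\ \ \Delta\boldsymbol{\theta}_{\mathcal{M}}=\boldsymbol{0},\ \ \Delta\boldsymbol{P}_{\mathcal{U}}=\boldsymbol{0},\ \ \Delta\boldsymbol{\theta}\neq\boldsymbol{0},$$ equals $\bar{\kappa}(\mathcal{G}^{\mathcal{M}})+1$, where $\bar{\kappa}(\mathcal{G}^{\mathcal{M}})$ is the vulnerable vertex connectivity of the augmented graph $\mathcal{G}^{\mathcal{M}}$.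
   Context: Grid: a graph with vertex set (buses) $\mathcal{N}=\{1,\dots,N\}$ and edge set (transmission lines) $\mathcal{L}$; line $l$ has reactance $x_l>0$ and edge weight $w_l=1/x_l$. For a line $l$ joining buses $n,m$, the incidence vector $\boldsymbol{m}_l\in\mathbb{R}^N$ has entry $1$ at $n$, $-1$ at $m$, and $0$ elsewhere; $\boldsymbol{B}=\sum_{l}\frac{1}{x_l}\boldsymbol{m}_l\boldsymbol{m}_l^T$ is the weighted Laplacian. $\|\cdot\|_0$ is the number of nonzero entries. For a vector $\boldsymbol{v}$ and index set $\mathcal{I}$, $\boldsymbol{v}_{\mathcal{I}}$ is the subvector with indices in $\mathcal{I}$. Augmented graph $\mathcal{G}^{\mathcal{M}}$: its vertices are those of $\mathcal{G}$ plus one additional dummy bus, which is unalterable. Let $\bar{\mathcal{M}}$ be $\mathcal{M}$ together with the dummy bus. The edges of $\mathcal{G}^{\mathcal{M}}$ are all edges of $\mathcal{G}$ plus an edge between every pair of buses in $\bar{\mathcal{M}}$ (with arbitrary positive weights). Thus the dummy bus is adjacent exactly to the buses in $\mathcal{M}$. Vertex cut: a set of vertices of a connected graph whose removal renders the graph disconnected. Given a vertex cut of $\mathcal{G}^{\mathcal{M}}$, $\mathcal{S}$ denotes the set of buses (outside the cut) disconnected from $\bar{\mathcal{M}}$ after removing the cut, i.e. those from which no remaining bus of $\bar{\mathcal{M}}$ can be reached; the cut itself is denoted (with slight abuse of notation) $N(\mathcal{S})$, and $N[\mathcal{S}]=\mathcal{S}\cup N(\mathcal{S})$. For minimum cuts,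 $N(\mathcal{S})$ is exactly the set of neighbors of $\mathcal{S}$ outside $\mathcal{S}$. Alterable buses $\mathcal{U}^c$: the buses of $\mathcal{N}$ not in $\mathcal{U}$ (the dummy bus is not alterable). A vulnerable vertex cut of $\mathcal{G}^{\mathcal{M}}$ is a vertex cut $N(\mathcal{S})$ with $|\mathcal{U}^c\cap N[\mathcal{S}]|\ge |N(\mathcal{S})|+1$. The vulnerable vertex connectivity $\bar{\kappa}(\mathcal{G}^{\mathcal{M}})$ is the minimum size of a vulnerable vertex cut of $\mathcal{G}^{\mathcal{M}}$, and is $\infty$ if none exists. The minimum of an infeasible problem is taken to be $\infty$. *)

theory Defs
  imports "HOL-Probability.Probability"
begin

(* Buses are the elements of a finite type 'n, so N = CARD('n).  A line joining the buses
   n and m is represented once, as (n, m) or as (m, n); the choice only fixes the sign of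
   its incidence vector, on which the Laplacian does not depend.  Asymmetry of the set of
   lines rules out loops and listing a line in both directions. *)

definition connected_graph :: "'v set \<Rightarrow> 'v rel \<Rightarrow> bool" where
  "connected_graph V E \<longleftrightarrow> (\<forall>u\<in>V. \<forall>v\<in>V. (u, v) \<in> (Restr E V)\<^sup>*)"

definition connected_grid :: "('n \<times> 'n) set \<Rightarrow> bool" where
  "connected_grid L \<longleftrightarrow> asym L \<and> connected_graph UNIV (L \<union> L\<inverse>)"

definition incidence_vector :: "'n \<times> 'n \<Rightarrow> real ^ 'n::finite" where
  "incidence_vector l = axis (fst l) 1 - axis (snd l) 1"

definition laplacian ::
    "('n \<times> 'n) set \<Rightarrow> ('n \<times> 'n \<Rightarrow> real) \<Rightarrow> real ^ 'n ^ 'n::finite" where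
  "laplacian L x =
     (\<Sum>l\<in>L. (1 / x l) *\<^sub>R (\<chi> i j. incidence_vector l $ i * incidence_vector l $ j))"

definition l0_norm :: "real ^ 'n::finite \<Rightarrow> nat" where
  "l0_norm v = card {i. v $ i \<noteq> 0}"

(* The infimum of a nonempty set of extended naturals is attained; that of the empty set
   is infinity. *)
definition min_sparsity ::
    "('n::finite \<times> 'n) set \<Rightarrow> ('n \<times> 'n \<Rightarrow> real) \<Rightarrow> 'n set \<Rightarrow> 'n set \<Rightarrow> enat" where
  "min_sparsity L x M U =
     Inf {enat (l0_norm \<Delta>P) | \<Delta>P \<Delta>\<theta>.
            \<Delta>P = laplacian L x *v \<Delta>\<theta> \<and> (\<forall>i\<in>M. \<Delta>\<theta> $ i = 0) \<and>
            (\<forall>i\<in>U. \<Delta>P $ i = 0) \<and> \<Delta>\<theta> \<noteq> 0}"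

(* The augmented graph has all of 'n option as its vertices; None is the dummy bus.  Its
   edge weights are omitted, since only connectivity is considered. *)

definition augmented_set :: "'n set \<Rightarrow> 'n option set" where
  "augmented_set M = insert None (Some ` M)"

definition augmented_edges :: "('n \<times> 'n) set \<Rightarrow> 'n set \<Rightarrow> 'n option rel" where
  "augmented_edges L M =
     {(Some u, Some v) | u v. (u, v) \<in> L \<union> L\<inverse>} \<union>
     {(a, b). a \<in> augmented_set M \<and> b \<in> augmented_set M \<and> a \<noteq> b}"

definition vertex_cut :: "'v set \<Rightarrow> 'v rel \<Rightarrow> 'v set \<Rightarrow> bool" where
  "vertex_cut V E C \<longleftrightarrow> C \<subseteq> V \<and> connected_graph V E \<and> \<not> connected_graph (V - C) E"

definition cut_off :: "('n \<times> 'n) set \<Rightarrow> 'n set \<Rightarrow> 'n option set \<Rightarrow> 'n option set" where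
  "cut_off L M C =
     {v. v \<notin> C \<and>
         (\<forall>b\<in>augmented_set M - C. (v, b) \<notin> (Restr (augmented_edges L M) (- C))\<^sup>*)}"

definition vulnerable_vertex_cut ::
    "('n \<times> 'n) set \<Rightarrow> 'n set \<Rightarrow> 'n set \<Rightarrow> 'n option set \<Rightarrow> bool" where
  "vulnerable_vertex_cut L M U C \<longleftrightarrow>
     vertex_cut UNIV (augmented_edges L M) C \<and>
     card (Some ` (- U) \<inter> (cut_off L M C \<union> C)) \<ge> card C + 1"

definition vulnerable_connectivity ::
    "('n::finite \<times> 'n) set \<Rightarrow> 'n set \<Rightarrow> 'n set \<Rightarrow> enat" where
  "vulnerable_connectivity L M U = Inf {enat (card C) | C. vulnerable_vertex_cut L M U C}"

(* Continuity of the distribution function; in particular every random variable with a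
   density qualifies. *)
definition continuous_rv :: "'a measure \<Rightarrow> ('a \<Rightarrow> real) \<Rightarrow> bool" where
  "continuous_rv P X \<longleftrightarrow>
     X \<in> borel_measurable P \<and> continuous_on UNIV (cdf (distr P borel X))"

end

theory Submission
  imports Defs
begin

text \<open>
  Both inequalities compare an attack with a vertex cut, and only one of them needs the randomness.

  A vulnerable cut of size \<open>k\<close> always admits an attack of sparsity at most \<open>k + 1\<close>.  The angles are
  perturbed only at the buses that the cut separates from the PMU buses; the injections then live on these
  buses and on the cut.  All but \<open>k + 1\<close> of them, at alterable buses, can be forced to vanish,
  because this leaves one linear condition less than there are unknowns
  (\<open>min_sparsity_le_vulnerable_cut\<close>).

  Conversely, let \<open>A\<close> be the support of the injections of an attack.  By Menger's theorem
  (\<open>menger\<close>) there are two cases.  Either fewer than \<open>card A\<close> buses separate \<open>A\<close> from \<open>M\<close>; they form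
  a vulnerable cut, because every bus of \<open>A\<close> is alterable and is cut off or belongs to the cut
  (\<open>small_separator_is_vulnerable_cut\<close>).  Or there are disjoint paths from all buses of \<open>A\<close> into \<open>M\<close>.
  In that case the attack exists only with probability zero, as the next paragraph explains.
  As there are finitely many sets \<open>A\<close>, one null set serves for all of them.

  The paths extend to a spanning subgraph in which every component contains a bus of \<open>M\<close> and at most
  one bus of \<open>A\<close> (\<open>linkage_extends_to_spanning_subgraph\<close>).  If the weights outside this subgraph were
  zero, then conservation of flow in each component would rule out attacks with injections in \<open>A\<close>
  (\<open>attack_free_spanning_subgraph\<close>).  From this single favourable choice of weights one passes to the
  random ones line by line.  Changing one weight is a rank-one perturbation, so injectivity is lost for
  at most one value (\<open>attack_free_upd_unique_exception\<close>), and by independence and continuity this value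
  is avoided almost surely (\<open>AE_attack_free_PiM\<close>).
\<close>

section \<open>Menger's theorem for directed graphs\<close>

definition separates :: "'v rel \<Rightarrow> 'v set \<Rightarrow> 'v set \<Rightarrow> 'v set \<Rightarrow> bool" where
  "separates E A B C \<longleftrightarrow> (\<forall>a\<in>A - C. \<forall>b\<in>B - C. (a, b) \<notin> (Restr E (- C))\<^sup>*)"

text \<open>
  A system of disjoint paths is encoded by disjoint branch sets: \<open>p a\<close> is a vertex set inside which
  \<open>a\<close> reaches \<open>B\<close>.  No path has to be chosen, and the branch sets may contain irrelevant vertices.
\<close>

definition linkage :: "'v rel \<Rightarrow> 'v set \<Rightarrow> 'v set \<Rightarrow> ('v \<Rightarrow> 'v set) \<Rightarrow> bool" where
  "linkage E A B p \<longleftrightarrow> disjoint_family_on p A \<and>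
     (\<forall>a\<in>A. a \<in> p a \<and> (\<exists>b\<in>B \<inter> p a. (a, b) \<in> (Restr E (p a))\<^sup>*))"

lemma rtrancl_Restr_converse:
  "(u, v) \<in> (Restr (E\<inverse>) X)\<^sup>* \<longleftrightarrow> (v, u) \<in> (Restr E X)\<^sup>*"
proof -
  have "Restr (E\<inverse>) X = (Restr E X)\<inverse>" by auto
  then show ?thesis by (simp add: rtrancl_converse)
qed

lemma separates_converse: "separates (E\<inverse>) B A C \<longleftrightarrow> separates E A B C"
  unfolding separates_def rtrancl_Restr_converse by blast

lemma linkage_mono: "E \<subseteq> E' \<Longrightarrow> linkage E A B p \<Longrightarrow> linkage E' A B p"
proof -
  assume "E \<subseteq> E'"
  then have "(Restr E X)\<^sup>* \<subseteq> (Restr E' X)\<^sup>*" for X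
    by (intro rtrancl_mono) blast
  then show "linkage E A B p \<Longrightarrow> linkage E' A B p"
    unfolding linkage_def by blast
qed

lemma separates_insert_edge:
  assumes "separates E A B S" and "x \<in> C \<or> y \<in> C" and "S \<subseteq> C"
  shows "separates (insert (x, y) E) A B C"
proof -
  have "Restr (insert (x, y) E) (- C) \<subseteq> Restr E (- S)"
    using assms(2,3) by auto
  then have "(Restr (insert (x, y) E) (- C))\<^sup>* \<subseteq> (Restr E (- S))\<^sup>*"
    by (rule rtrancl_mono)
  then show ?thesis
    using assms(1,3) unfolding separates_def by blast
qed

text \<open>
  A walk from \<open>A\<close> to \<open>B\<close> has to meet \<open>P\<close>.  Up to its first vertex in \<open>P\<close> it cannot use the new edge,
  whose tail \<open>x\<close> lies in \<open>P\<close>, so this initial part is a walk of the old graph and meets \<open>C\<close>.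
\<close>

lemma separates_via_separator_left:
  assumes P: "separates (insert (x, y) E) A B P" and x: "x \<in> P"
    and C: "separates E A P C"
  shows "separates (insert (x, y) E) A B C"
  unfolding separates_def
proof (intro ballI notI)
  fix a b
  assume a: "a \<in> A - C" and b: "b \<in> B - C"
    and ab: "(a, b) \<in> (Restr (insert (x, y) E) (- C))\<^sup>*"
  have noP: "v \<notin> P" if "(a, v) \<in> (Restr E (- C))\<^sup>*" "v \<notin> C" for v
    using C a that unfolding separates_def by blast
  have "(a, v) \<in> (Restr E (- C))\<^sup>* \<and> (a, v) \<in> (Restr (insert (x, y) E) (- P))\<^sup>* \<and> v \<notin> C"
    if "(a, v) \<in> (Restr (insert (x, y) E) (- C))\<^sup>*" for v
    using that
  proof induction
    case base
    then show ?case using a by simp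
  next
    case (step u v)
    then have u: "u \<notin> P" using noP by blast
    with x step have "(u, v) \<in> Restr E (- C)" by auto
    with step have 1: "(a, v) \<in> (Restr E (- C))\<^sup>*" by (meson rtrancl.rtrancl_into_rtrancl)
    moreover have "v \<notin> C" using step by auto
    ultimately have v: "v \<notin> P" using noP by blast
    then have "(u, v) \<in> Restr (insert (x, y) E) (- P)" using u step by auto
    with step have "(a, v) \<in> (Restr (insert (x, y) E) (- P))\<^sup>*"
      by (meson rtrancl.rtrancl_into_rtrancl)
    with 1 \<open>v \<notin> C\<close> show ?case by blast
  qed
  from this[OF ab] have "(a, b) \<in> (Restr E (- C))\<^sup>*" "(a, b) \<in> (Restr (insert (x, y) E) (- P))\<^sup>*"
    by auto
  moreover have "a \<notin> P" using noP a by blast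
  moreover have "b \<notin> P" using noP calculation(1) b by blast
  ultimately show False using P a b unfolding separates_def by blast
qed

lemma separates_via_separator_right:
  assumes Q: "separates (insert (x, y) E) A B Q" and y: "y \<in> Q"
    and C: "separates E Q B C"
  shows "separates (insert (x, y) E) A B C"
proof -
  have conv: "(insert (x, y) E)\<inverse> = insert (y, x) (E\<inverse>)" by auto
  have "separates (insert (y, x) (E\<inverse>)) B A C"
    using Q C y separates_via_separator_left[of y x "E\<inverse>" B A Q C]
    by (simp add: separates_converse flip: conv)
  then show ?thesis by (simp add: separates_converse flip: conv)
qed

text \<open>
  If \<open>R\<close> can be left only through \<open>S\<close>, and \<open>S\<close> meets the branch set \<open>D\<close> at most in the end point \<open>b\<close>,
  then a walk that starts in \<open>R \<union> S\<close> cannot leave \<open>R \<union> S\<close> before it has ended.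
\<close>

lemma truncate_walk:
  assumes ab: "(a, b) \<in> (Restr E D)\<^sup>*" and "a \<in> D" and S: "S \<inter> D \<subseteq> {b}"
    and a: "a \<in> R \<union> S" and closed: "\<And>u v. u \<in> R \<Longrightarrow> (u, v) \<in> E \<Longrightarrow> v \<in> R \<union> S"
  shows "(a, b) \<in> (Restr E (D \<inter> (R \<union> S)))\<^sup>* \<and> b \<in> R \<union> S"
proof -
  define T where "T = Restr E (D \<inter> (R \<union> S))"
  have "(a, v) \<in> T\<^sup>* \<and> v \<in> R \<or> (a, b) \<in> T\<^sup>* \<and> b \<in> R \<union> S" if "(a, v) \<in> (Restr E D)\<^sup>*" for v
    using that
  proof induction
    case base
    then show ?case using a S \<open>a \<in> D\<close> by auto
  next
    case (step u v)
    show ?case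
    proof (cases "(a, b) \<in> T\<^sup>* \<and> b \<in> R \<union> S")
      case False
      with step have u: "(a, u) \<in> T\<^sup>*" "u \<in> R" by auto
      have "v \<in> R \<union> S" using closed u step by blast
      moreover have "(u, v) \<in> T" using calculation u step unfolding T_def by blast
      then have "(a, v) \<in> T\<^sup>*" using u by (meson rtrancl.rtrancl_into_rtrancl)
      moreover have "v \<in> D" using step by blast
      ultimately show ?thesis using S by blast
    qed blast
  qed
  from this[OF ab] show ?thesis unfolding T_def by blast
qed

text \<open>
  Goering's induction on the edges.  Suppose that deleting the edge \<open>(x, y)\<close> creates a separator \<open>S\<close>
  smaller than \<open>A\<close>.  Then \<open>P = S \<union> {x}\<close> and \<open>Q = S \<union> {y}\<close> separate \<open>A\<close> from \<open>B\<close> in the whole graph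
  and have exactly \<open>card A\<close> elements.  By induction \<open>A\<close> is linked onto \<open>P\<close>, and \<open>Q\<close> into \<open>B\<close>, without
  using \<open>(x, y)\<close>.  Since \<open>S\<close> separates the two linkages, they can be glued along \<open>S\<close> and along the edge
  \<open>(x, y)\<close>.
\<close>

theorem menger:
  assumes "finite E" and "finite A"
    and "\<And>C. finite C \<Longrightarrow> separates E A B C \<Longrightarrow> card A \<le> card C"
  shows "\<exists>p. linkage E A B p"
  using assms
proof (induction E arbitrary: A B rule: finite_induct)
  case empty
  have "separates {} A B (A \<inter> B)"
    unfolding separates_def by auto
  with empty have "card A \<le> card (A \<inter> B)" by blast
  with \<open>finite A\<close> have "A \<inter> B = A" by (intro card_seteq) auto
  then have "linkage {} A B (\<lambda>a. {a})"
    unfolding linkage_def disjoint_family_on_def by auto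
  then show ?case by blast
next
  case (insert e E)
  obtain x y where e: "e = (x, y)" by (cases e)
  note min = insert.prems(2)[unfolded e]
  show ?case
  proof (cases "\<forall>C. finite C \<longrightarrow> separates E A B C \<longrightarrow> card A \<le> card C")
    case True
    then obtain p where "linkage E A B p" using insert.IH[OF insert.prems(1)] by blast
    then show ?thesis using linkage_mono[of E "insert e E"] by blast
  next
    case False
    then obtain S where S: "finite S" "separates E A B S" "card S < card A" by force
    define P where "P = insert x S"
    define Q where "Q = insert y S"
    have P: "separates (insert (x, y) E) A B P" and Q: "separates (insert (x, y) E) A B Q"
      unfolding P_def Q_def by (intro separates_insert_edge[OF S(2)]; blast)+
    have fin: "finite P" "finite Q" unfolding P_def Q_def using S by auto
    have "card A \<le> card P" "card A \<le> card Q" using min P Q fin by auto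
    with S have card: "card P = card A" "card Q = card A" and xy: "x \<notin> S" "y \<notin> S"
      unfolding P_def Q_def by (auto simp: card_insert_if split: if_splits)
    have "card A \<le> card C" if "finite C" "separates E A P C" for C
      using min separates_via_separator_left[OF P _ that(2)] that(1) P_def by blast
    then obtain p where p: "linkage E A P p" using insert.IH[OF insert.prems(1)] by blast
    have "card Q \<le> card C" if "finite C" "separates E Q B C" for C
      using min separates_via_separator_right[OF Q _ that(2)] that(1) Q_def card by force
    then obtain q where q: "linkage E Q B q" using insert.IH[OF fin(2)] by blast

    \<comment> \<open>The branch set of \<open>a\<close> meets \<open>P\<close> in the single vertex \<open>\<beta> a\<close>; \<open>\<tau> a\<close> is where the path goes on in \<open>Q\<close>.\<close>
    have pdisj: "a = a'" if "a \<in> A" "a' \<in> A" "v \<in> p a" "v \<in> p a'" for a a' v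
      using p that unfolding linkage_def disjoint_family_on_def by blast
    have qdisj: "t = t'" if "t \<in> Q" "t' \<in> Q" "v \<in> q t" "v \<in> q t'" for t t' v
      using q that unfolding linkage_def disjoint_family_on_def by blast
    obtain \<beta> where \<beta>: "\<beta> a \<in> P" "\<beta> a \<in> p a" "(a, \<beta> a) \<in> (Restr E (p a))\<^sup>*" "a \<in> p a"
      if "a \<in> A" for a
      using p unfolding linkage_def by (metis IntE)
    have "inj_on \<beta> A" using pdisj \<beta> by (metis inj_onI)
    then have "card (\<beta> ` A) = card P" using card by (simp add: card_image)
    then have \<beta>A: "\<beta> ` A = P"
      using \<beta>(1) fin by (intro card_seteq) auto
    have pP: "v = \<beta> a" if "a \<in> A" "v \<in> p a" "v \<in> P" for a v
      using that \<beta>A pdisj \<beta>(2) by (metis imageE)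
    have qQ: "v = t" if "t \<in> Q" "v \<in> q t" "v \<in> Q" for t v
      using that qdisj q unfolding linkage_def by metis
    define \<tau> where "\<tau> a = (if \<beta> a = x then y else \<beta> a)" for a
    have \<tau>Q: "\<tau> a \<in> Q" if "a \<in> A" for a
      using \<beta>(1)[OF that] unfolding \<tau>_def P_def Q_def by auto
    have \<tau>inj: "a = a'" if "a \<in> A" "a' \<in> A" "\<tau> a = \<tau> a'" for a a'
    proof -
      have "\<beta> a = \<beta> a'"
        using that(3) xy \<beta>(1)[OF that(1)] \<beta>(1)[OF that(2)]
        unfolding \<tau>_def P_def by (auto split: if_splits)
      with \<open>inj_on \<beta> A\<close> that show ?thesis by (auto dest: inj_onD)
    qed

    \<comment> \<open>The sides of \<open>S\<close>.  Branch sets may stray to the wrong side, so they are cut down to their own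
      side before they are united; after that they can only meet in \<open>S\<close>.\<close>
    define RA where "RA = {v. \<exists>a\<in>A - S. (a, v) \<in> (Restr E (- S))\<^sup>*} - S"
    define RB where "RB = {v. \<exists>b\<in>B - S. (v, b) \<in> (Restr E (- S))\<^sup>*} - S"
    have RAB: "RA \<inter> RB = {}"
      using S(2) unfolding RA_def RB_def separates_def by (auto dest: rtrancl_trans)
    have RA_closed: "v \<in> RA \<union> S" if "u \<in> RA" "(u, v) \<in> E" for u v
    proof (cases "v \<in> S")
      case False
      then have "(u, v) \<in> Restr E (- S)" using that unfolding RA_def by blast
      then show ?thesis using that False unfolding RA_def
        by (auto intro: rtrancl.rtrancl_into_rtrancl)
    qed blast
    have RB_closed: "v \<in> RB \<union> S" if "u \<in> RB" "(u, v) \<in> E\<inverse>" for u v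
    proof (cases "v \<in> S")
      case False
      then have "(v, u) \<in> Restr E (- S)" using that unfolding RB_def by blast
      then show ?thesis using that False unfolding RB_def
        by (auto intro: converse_rtrancl_into_rtrancl)
    qed blast
    define r where "r a = p a \<inter> (RA \<union> S) \<union> q (\<tau> a) \<inter> (RB \<union> S)" for a
    have cross: "a = a'" if "a \<in> A" "a' \<in> A" "v \<in> p a \<inter> (RA \<union> S)" "v \<in> q (\<tau> a') \<inter> (RB \<union> S)"
      for a a' v
    proof -
      have v: "v \<in> S" using that RAB by blast
      have "v = \<beta> a" using pP that v unfolding P_def by blast
      then have "\<tau> a = v" using v xy unfolding \<tau>_def by auto
      moreover have "v = \<tau> a'" using qQ[OF \<tau>Q] that v unfolding Q_def by blast
      ultimately show ?thesis using \<tau>inj that by blast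
    qed
    have rdisj: "a = a'" if "a \<in> A" "a' \<in> A" "v \<in> r a" "v \<in> r a'" for a a' v
      using that cross[of a a' v] cross[of a' a v] pdisj[of a a' v]
        qdisj[OF \<tau>Q \<tau>Q, of a a' v] \<tau>inj[of a a'] unfolding r_def by blast
    have "a \<in> r a \<and> (\<exists>b\<in>B \<inter> r a. (a, b) \<in> (Restr (insert (x, y) E) (r a))\<^sup>*)" if a: "a \<in> A" for a
    proof -
      let ?G = "(Restr (insert (x, y) E) (r a))\<^sup>*"
      have aR: "a \<in> RA \<union> S" using a unfolding RA_def by auto
      have 1: "(a, \<beta> a) \<in> (Restr E (p a \<inter> (RA \<union> S)))\<^sup>* \<and> \<beta> a \<in> RA \<union> S"
      proof (rule truncate_walk[OF \<beta>(3,4)[OF a] _ aR RA_closed])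
        show "S \<inter> p a \<subseteq> {\<beta> a}" using pP[OF a] unfolding P_def by blast
      qed
      obtain b where b: "b \<in> B" "b \<in> q (\<tau> a)" "(\<tau> a, b) \<in> (Restr E (q (\<tau> a)))\<^sup>*" "\<tau> a \<in> q (\<tau> a)"
        using q \<tau>Q[OF a] unfolding linkage_def by blast
      have bR: "b \<in> RB \<union> S" using b unfolding RB_def by auto
      have 2: "(b, \<tau> a) \<in> (Restr (E\<inverse>) (q (\<tau> a) \<inter> (RB \<union> S)))\<^sup>* \<and> \<tau> a \<in> RB \<union> S"
      proof (rule truncate_walk[OF _ b(2) _ bR RB_closed])
        show "(b, \<tau> a) \<in> (Restr (E\<inverse>) (q (\<tau> a)))\<^sup>*"
          using b(3) by (simp add: rtrancl_Restr_converse)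
        show "S \<inter> q (\<tau> a) \<subseteq> {\<tau> a}" using qQ[OF \<tau>Q[OF a]] unfolding Q_def by blast
      qed
      have "(Restr E (p a \<inter> (RA \<union> S)))\<^sup>* \<subseteq> ?G" "(Restr E (q (\<tau> a) \<inter> (RB \<union> S)))\<^sup>* \<subseteq> ?G"
        by (intro rtrancl_mono; auto simp: r_def)+
      with 1 2 have "(a, \<beta> a) \<in> ?G" "(\<tau> a, b) \<in> ?G" unfolding rtrancl_Restr_converse by auto
      moreover have "(\<beta> a, \<tau> a) \<in> ?G"
      proof (cases "\<beta> a = x")
        case True
        moreover have "\<beta> a \<in> r a" "\<tau> a \<in> r a" using \<beta>[OF a] b 1 2 unfolding r_def by auto
        ultimately show ?thesis unfolding \<tau>_def by auto
      qed (simp add: \<tau>_def)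
      ultimately have "(a, b) \<in> ?G" by (meson rtrancl_trans)
      then show ?thesis using b bR aR \<beta>[OF a] unfolding r_def by auto
    qed
    with rdisj have "linkage (insert e E) A B r"
      unfolding linkage_def disjoint_family_on_def e by blast
    then show ?thesis by blast
  qed
qed

section \<open>Spanning subgraphs that extend a linkage\<close>

lemma rtrancl_closed:
  assumes "(a, v) \<in> R\<^sup>*" and "a \<in> K" and "\<And>u w. (u, w) \<in> R \<Longrightarrow> u \<in> K \<Longrightarrow> w \<in> K"
  shows "v \<in> K"
  using assms by (induction) auto

text \<open>
  Take an edge set \<open>F\<close> that contains all edges inside the branch sets and is maximal among those that
  keep the vertices of \<open>A\<close> in different components.  A component without a vertex of \<open>M\<close> contains no
  vertex of \<open>A\<close> either, since the branch sets reach \<open>M\<close>.  Hence adding an edge that leaves it joins no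
  two vertices of \<open>A\<close>, against maximality.
\<close>

lemma linkage_extends_to_spanning_subgraph:
  fixes L :: "'n::finite rel"
  assumes conn: "connected_graph UNIV (L \<union> L\<inverse>)" and p: "linkage (L \<union> L\<inverse>) A M p" and "M \<noteq> {}"
  obtains F where "F \<subseteq> L"
    and "\<And>a a'. a \<in> A \<Longrightarrow> a' \<in> A \<Longrightarrow> (a, a') \<in> (F \<union> F\<inverse>)\<^sup>* \<Longrightarrow> a = a'"
    and "\<And>v. \<exists>m\<in>M. (v, m) \<in> (F \<union> F\<inverse>)\<^sup>*"
proof -
  define apart where "apart F \<longleftrightarrow> (\<forall>a\<in>A. \<forall>a'\<in>A. (a, a') \<in> (F \<union> F\<inverse>)\<^sup>* \<longrightarrow> a = a')" for F :: "'n rel"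
  define F0 where "F0 = {(u, v) \<in> L. \<exists>a\<in>A. u \<in> p a \<and> v \<in> p a}"
  have disj: "a = a'" if "a \<in> A" "a' \<in> A" "v \<in> p a" "v \<in> p a'" for a a' v
    using p that unfolding linkage_def disjoint_family_on_def by blast
  have self: "a \<in> p a" if "a \<in> A" for a
    using p that unfolding linkage_def by blast
  have "apart F0"
    unfolding apart_def
  proof (intro ballI impI)
    fix a a' assume a: "a \<in> A" "a' \<in> A" and aa: "(a, a') \<in> (F0 \<union> F0\<inverse>)\<^sup>*"
    have "a' \<in> p a"
    proof (rule rtrancl_closed[OF aa self[OF a(1)]])
      fix u w assume "(u, w) \<in> F0 \<union> F0\<inverse>" "u \<in> p a"
      then show "w \<in> p a" using disj a(1) unfolding F0_def by blast
    qed
    then show "a = a'" using disj self a by blast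
  qed
  then have "F0 \<in> {F. F \<subseteq> L \<and> apart F}" unfolding F0_def by blast
  from finite_has_maximal2[OF _ this] obtain F where
    F: "F0 \<subseteq> F" "F \<subseteq> L" "apart F" and max: "\<And>F'. F' \<subseteq> L \<Longrightarrow> apart F' \<Longrightarrow> F \<subseteq> F' \<Longrightarrow> F = F'"
    by auto
  let ?R = "(F \<union> F\<inverse>)\<^sup>*"
  have sym: "(u, v) \<in> ?R \<Longrightarrow> (v, u) \<in> ?R" for u v
    using sym_rtrancl[of "F \<union> F\<inverse>"] by (auto simp: sym_def)
  have reach: "\<exists>m\<in>M. (a, m) \<in> ?R" if a: "a \<in> A" for a
  proof -
    obtain b where b: "b \<in> M" "(a, b) \<in> (Restr (L \<union> L\<inverse>) (p a))\<^sup>*"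
      using p a unfolding linkage_def by blast
    have "Restr (L \<union> L\<inverse>) (p a) \<subseteq> F0 \<union> F0\<inverse>" unfolding F0_def using a by auto
    also have "\<dots> \<subseteq> F \<union> F\<inverse>" using F(1) by blast
    finally show ?thesis using b rtrancl_mono by blast
  qed
  have "\<exists>m\<in>M. (v, m) \<in> ?R" for v
  proof (rule ccontr)
    assume no: "\<not> (\<exists>m\<in>M. (v, m) \<in> ?R)"
    define K where "K = {u. (v, u) \<in> ?R}"
    have vK: "v \<in> K" unfolding K_def by blast
    have KA: "K \<inter> A = {}"
      using no reach rtrancl_trans[of v] unfolding K_def by blast
    obtain m where "m \<in> M" using \<open>M \<noteq> {}\<close> by blast
    then have "m \<notin> K" using no unfolding K_def by blast
    moreover have "(v, m) \<in> (L \<union> L\<inverse>)\<^sup>*"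
      using conn unfolding connected_graph_def by auto
    ultimately obtain u w where uw: "(u, w) \<in> L \<union> L\<inverse>" "u \<in> K" "w \<notin> K"
      using rtrancl_closed[of v m "L \<union> L\<inverse>" K] vK by blast
    define e where "e = (if (u, w) \<in> L then (u, w) else (w, u))"
    have e: "e \<in> L" "e = (u, w) \<or> e = (w, u)" using uw(1) unfolding e_def by auto
    have FK: "w' \<in> K \<longleftrightarrow> u' \<in> K" if "(u', w') \<in> F \<union> F\<inverse>" for u' w'
      using that unfolding K_def by (metis (no_types, lifting) Un_iff converse_iff mem_Collect_eq rtrancl.rtrancl_into_rtrancl)
    have "apart (insert e F)"
      unfolding apart_def
    proof (intro ballI impI)
      fix a a' assume a: "a \<in> A" "a' \<in> A" and aa: "(a, a') \<in> (insert e F \<union> (insert e F)\<inverse>)\<^sup>*"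
      define H where "H = {z. (a, z) \<in> ?R}"
      have FH: "w' \<in> H" if "(u', w') \<in> F \<union> F\<inverse>" "u' \<in> H" for u' w'
        using that unfolding H_def by (auto intro: rtrancl.rtrancl_into_rtrancl)
      have uH: "u \<notin> H"
      proof
        assume "u \<in> H"
        then have "(u, a) \<in> ?R" using sym unfolding H_def by blast
        then have "a \<in> K" using uw(2) rtrancl_trans[of v u _ a] unfolding K_def by blast
        with KA a show False by blast
      qed
      \<comment> \<open>The component of \<open>a\<close> after the edge \<open>e\<close> has been added: it absorbs \<open>K\<close> exactly if it contains the end \<open>w\<close> of \<open>e\<close>.\<close>
      define J where "J = (if w \<in> H then H \<union> K else H)"
      have "a' \<in> J"
      proof (rule rtrancl_closed[OF aa])
        show "a \<in> J" unfolding J_def H_def by auto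
      next
        fix u' w' assume *: "(u', w') \<in> insert e F \<union> (insert e F)\<inverse>" "u' \<in> J"
        then consider "(u', w') \<in> F \<union> F\<inverse>" | "u' = u" "w' = w" | "u' = w" "w' = u"
          using e(2) by auto
        then show "w' \<in> J"
        proof cases
          case 1
          then show ?thesis using FH FK *(2) unfolding J_def by (auto split: if_splits)
        next
          case 2
          then show ?thesis using *(2) uH unfolding J_def by (auto split: if_splits)
        next
          case 3
          then show ?thesis using *(2) uw unfolding J_def by (auto split: if_splits)
        qed
      qed
      then have "a' \<in> H" using KA a unfolding J_def by (auto split: if_splits)
      then show "a = a'" using F(3) a unfolding apart_def H_def by blast
    qed
    with max[of "insert e F"] F(2) e(1) have "e \<in> F" by blast
    then show False using FK[of u w] uw e(2) by auto
  qed
  with F that show ?thesis unfolding apart_def by blast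
qed

section \<open>The Laplacian\<close>

lemma incidence_vector_nth:
  "incidence_vector l $ i = of_bool (i = fst l) - of_bool (i = snd l)"
  by (auto simp: incidence_vector_def axis_def)

lemma laplacian_entry:
  "laplacian L x $ i $ j = (\<Sum>l\<in>L. 1 / x l * incidence_vector l $ i * incidence_vector l $ j)"
  unfolding laplacian_def by (simp add: sum_component mult.assoc divide_inverse)

lemma inner_incidence_vector:
  "(\<Sum>j\<in>UNIV. incidence_vector l $ j * \<theta> $ j) = \<theta> $ fst l - \<theta> $ snd l"
  by (simp add: incidence_vector_nth left_diff_distrib sum_subtractf of_bool_def if_distrib[of "\<lambda>c. c * _"] cong: if_cong)

lemma laplacian_mult_nth:
  "(laplacian L x *v \<theta>) $ i =
     (\<Sum>l\<in>L. 1 / x l * (\<theta> $ fst l - \<theta> $ snd l) * incidence_vector l $ i)"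
proof -
  have "(laplacian L x *v \<theta>) $ i = (\<Sum>j\<in>UNIV. \<Sum>l\<in>L. 1 / x l * incidence_vector l $ i * (incidence_vector l $ j * \<theta> $ j))"
    by (simp add: matrix_vector_mult_def laplacian_entry sum_distrib_right mult.assoc)
  also have "\<dots> = (\<Sum>l\<in>L. 1 / x l * incidence_vector l $ i * (\<Sum>j\<in>UNIV. incidence_vector l $ j * \<theta> $ j))"
    by (subst sum.swap) (simp add: sum_distrib_left)
  finally show ?thesis unfolding inner_incidence_vector by (simp add: mult_ac)
qed

lemma laplacian_energy:
  "(\<Sum>i\<in>UNIV. \<theta> $ i * (laplacian L x *v \<theta>) $ i) = (\<Sum>l\<in>L. (\<theta> $ fst l - \<theta> $ snd l)\<^sup>2 / x l)"
proof -
  have "(\<Sum>i\<in>UNIV. \<theta> $ i * (laplacian L x *v \<theta>) $ i) =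
    (\<Sum>l\<in>L. 1 / x l * (\<theta> $ fst l - \<theta> $ snd l) * (\<Sum>i\<in>UNIV. incidence_vector l $ i * \<theta> $ i))"
    unfolding laplacian_mult_nth sum_distrib_left by (subst sum.swap) (simp add: mult_ac)
  then show ?thesis unfolding inner_incidence_vector by (simp add: power2_eq_square mult_ac)
qed

text \<open>
  If no line of nonzero weight leaves \<open>K\<close>, what is injected into \<open>K\<close> is absorbed in \<open>K\<close>.  A line with
  \<open>x l = 0\<close> has weight \<open>1 / 0 = 0\<close>, that is, it is absent from the Laplacian.
\<close>

lemma laplacian_sum_isolated:
  assumes "\<And>l. l \<in> L \<Longrightarrow> x l \<noteq> 0 \<Longrightarrow> fst l \<in> K \<longleftrightarrow> snd l \<in> K"
  shows "(\<Sum>i\<in>K. (laplacian L x *v \<theta>) $ i) = 0"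
proof -
  have "(\<Sum>i\<in>K. incidence_vector l $ i) = of_bool (fst l \<in> K) - of_bool (snd l \<in> K)" for l :: "'a \<times> 'a"
    by (simp add: incidence_vector_nth sum_subtractf of_bool_def)
  moreover have "(\<Sum>i\<in>K. (laplacian L x *v \<theta>) $ i) =
    (\<Sum>l\<in>L. 1 / x l * (\<theta> $ fst l - \<theta> $ snd l) * (\<Sum>i\<in>K. incidence_vector l $ i))"
    unfolding laplacian_mult_nth sum_distrib_left by (rule sum.swap)
  ultimately show ?thesis using assms by (auto intro!: sum.neutral)
qed

section \<open>Injection patterns without attacks\<close>

text \<open>
  Injectivity of the submatrix of the Laplacian with columns \<open>- M\<close> and rows \<open>- A\<close>: a nonzero attack
  that respects the PMU buses must inject power at some bus outside \<open>A\<close>.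
\<close>

definition attack_free ::
    "('n \<times> 'n) set \<Rightarrow> ('n \<times> 'n \<Rightarrow> real) \<Rightarrow> 'n set \<Rightarrow> 'n::finite set \<Rightarrow> bool" where
  "attack_free L x M A \<longleftrightarrow>
     (\<forall>\<theta>. (\<forall>i\<in>M. \<theta> $ i = 0) \<longrightarrow> (\<forall>i. i \<notin> A \<longrightarrow> (laplacian L x *v \<theta>) $ i = 0) \<longrightarrow> \<theta> = 0)"

text \<open>
  The witness for genericity.  The indicator of \<open>F\<close> as reactance gives weight 1 to the lines of \<open>F\<close> and
  weight 0 to the others, because \<open>1 / 0 = 0\<close>.  At most one bus of a component of \<open>F\<close> may have a nonzero
  injection, and the injections of a component add up to zero; hence all injections vanish.  Then the
  energy of \<open>\<theta>\<close> is zero, so \<open>\<theta>\<close> is constant on every component, with the value 0 that it takes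
  on \<open>M\<close>.
\<close>

lemma attack_free_spanning_subgraph:
  fixes L :: "('n::finite \<times> 'n) set"
  assumes "F \<subseteq> L"
    and apart: "\<And>a a'. a \<in> A \<Longrightarrow> a' \<in> A \<Longrightarrow> (a, a') \<in> (F \<union> F\<inverse>)\<^sup>* \<Longrightarrow> a = a'"
    and reach: "\<And>v. \<exists>m\<in>M. (v, m) \<in> (F \<union> F\<inverse>)\<^sup>*"
  shows "attack_free L (indicator F) M A"
  unfolding attack_free_def
proof (intro allI impI)
  fix \<theta> :: "real ^ 'n"
  assume M: "\<forall>i\<in>M. \<theta> $ i = 0" and A: "\<forall>i. i \<notin> A \<longrightarrow> (laplacian L (indicator F) *v \<theta>) $ i = 0"
  let ?B = "laplacian L (indicator F) *v \<theta>"
  have zero: "?B $ a = 0" for a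
  proof (cases "a \<in> A")
    case True
    define K where "K = {v. (a, v) \<in> (F \<union> F\<inverse>)\<^sup>*}"
    have "fst l \<in> K \<longleftrightarrow> snd l \<in> K" if "l \<in> F" for l
      using that unfolding K_def
      by (metis (no_types, lifting) UnI1 UnI2 converse_iff mem_Collect_eq prod.collapse rtrancl.rtrancl_into_rtrancl)
    then have "(\<Sum>i\<in>K. ?B $ i) = 0"
      by (intro laplacian_sum_isolated) (auto simp: indicator_def split: if_splits)
    moreover have "?B $ i = 0" if "i \<in> K - {a}" for i
      using that A apart True unfolding K_def by blast
    then have "(\<Sum>i\<in>K. ?B $ i) = ?B $ a"
      by (subst sum.mono_neutral_right[of K "{a}"]) (auto simp: K_def)
    ultimately show ?thesis by simp
  qed (use A in blast)
  have "(\<Sum>l\<in>L. (\<theta> $ fst l - \<theta> $ snd l)\<^sup>2 / indicator F l) = 0"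
    unfolding laplacian_energy[symmetric] by (simp add: zero)
  then have flat0: "\<forall>l\<in>L. (\<theta> $ fst l - \<theta> $ snd l)\<^sup>2 / indicator F l = 0"
    by (subst (asm) sum_nonneg_eq_0_iff) auto
  have flat: "\<theta> $ u = \<theta> $ v" if "(u, v) \<in> F" for u v
    using bspec[OF flat0, of "(u, v)"] that \<open>F \<subseteq> L\<close> by auto
  have "\<theta> $ v = 0" for v
  proof -
    obtain m where m: "m \<in> M" "(v, m) \<in> (F \<union> F\<inverse>)\<^sup>*" using reach by blast
    have "m \<in> {z. \<theta> $ z = \<theta> $ v}"
      by (rule rtrancl_closed[OF m(2)]) (use flat in auto)
    then show ?thesis using M m by simp
  qed
  then show "\<theta> = 0" by (simp add: vec_eq_iff)
qed

lemma laplacian_mult_upd: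
  fixes \<theta> :: "real ^ 'n::finite"
  assumes "l \<in> L"
  shows "(laplacian L (x(l := t)) *v \<theta>) $ i = (laplacian L (x(l := s)) *v \<theta>) $ i
     + (1 / t - 1 / s) * (\<theta> $ fst l - \<theta> $ snd l) * incidence_vector l $ i"
proof -
  have "(laplacian L (x(l := r)) *v \<theta>) $ i =
    1 / r * (\<theta> $ fst l - \<theta> $ snd l) * incidence_vector l $ i
    + (\<Sum>k\<in>L - {l}. 1 / x k * (\<theta> $ fst k - \<theta> $ snd k) * incidence_vector k $ i)" for r
    unfolding laplacian_mult_nth using assms by (subst sum.remove[of _ l]) auto
  from this[of t] this[of s] show ?thesis by (simp add: algebra_simps diff_divide_distrib)
qed

text \<open>
  Changing one reactance perturbs the Laplacian by a multiple of \<open>m m\<^sup>T\<close>, where \<open>m\<close> is the incidence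
  vector of \<open>l\<close>.  Given injectivity for the value \<open>s\<close>, a nonzero attack for the value \<open>t\<close> is therefore
  determined up to a factor, and its difference along \<open>l\<close> determines \<open>1 / t\<close>.
\<close>

lemma attack_free_upd_unique_exception:
  fixes L :: "('n::finite \<times> 'n) set"
  assumes l: "l \<in> L" and free: "attack_free L (x(l := s)) M A"
    and t: "\<not> attack_free L (x(l := t)) M A" and t': "\<not> attack_free L (x(l := t')) M A"
  shows "t = t'"
proof -
  let ?B = "\<lambda>r. laplacian L (x(l := r))"
  let ?d = "\<lambda>\<theta>::real^'n. \<theta> $ fst l - \<theta> $ snd l"
  have inj: "\<theta> = 0" if "\<forall>i\<in>M. \<theta> $ i = 0" "\<And>i. i \<notin> A \<Longrightarrow> (?B s *v \<theta>) $ i = 0" for \<theta>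
    using free that unfolding attack_free_def by blast
  have bad: "\<exists>\<theta>. (\<forall>i\<in>M. \<theta> $ i = 0) \<and> ?d \<theta> \<noteq> 0 \<and>
      (\<forall>i. i \<notin> A \<longrightarrow> (?B s *v \<theta>) $ i = - (1 / r - 1 / s) * ?d \<theta> * incidence_vector l $ i)"
    if r: "\<not> attack_free L (x(l := r)) M A" for r
  proof -
    obtain \<theta> where \<theta>: "\<forall>i\<in>M. \<theta> $ i = 0" "\<And>i. i \<notin> A \<Longrightarrow> (?B r *v \<theta>) $ i = 0" "\<theta> \<noteq> 0"
      using r unfolding attack_free_def by blast
    have eq: "(?B s *v \<theta>) $ i = - (1 / r - 1 / s) * ?d \<theta> * incidence_vector l $ i" if "i \<notin> A" for i
      using \<theta>(2)[OF that] laplacian_mult_upd[OF l, of x r \<theta> i s] by linarith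
    moreover have "?d \<theta> \<noteq> 0"
    proof
      assume "?d \<theta> = 0"
      then have "\<theta> = 0" using eq by (intro inj \<theta>(1)) simp
      with \<theta>(3) show False ..
    qed
    ultimately show ?thesis using \<theta>(1) by blast
  qed
  obtain \<theta> where \<theta>: "\<forall>i\<in>M. \<theta> $ i = 0" "?d \<theta> \<noteq> 0"
    "\<And>i. i \<notin> A \<Longrightarrow> (?B s *v \<theta>) $ i = - (1 / t - 1 / s) * ?d \<theta> * incidence_vector l $ i"
    using bad[OF t] by blast
  obtain \<theta>' where \<theta>': "\<forall>i\<in>M. \<theta>' $ i = 0" "?d \<theta>' \<noteq> 0"
    "\<And>i. i \<notin> A \<Longrightarrow> (?B s *v \<theta>') $ i = - (1 / t' - 1 / s) * ?d \<theta>' * incidence_vector l $ i"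
    using bad[OF t'] by blast
  \<comment> \<open>Coefficients chosen so that the two right-hand sides, both multiples of the incidence vector, cancel.\<close>
  define c where "c = (1 / t' - 1 / s) * ?d \<theta>'"
  define c' where "c' = (1 / t - 1 / s) * ?d \<theta>"
  have "c *s \<theta> - c' *s \<theta>' = 0"
  proof (rule inj)
    show "\<forall>i\<in>M. (c *s \<theta> - c' *s \<theta>') $ i = 0" using \<theta>(1) \<theta>'(1) by simp
    fix i assume "i \<notin> A"
    then show "(?B s *v (c *s \<theta> - c' *s \<theta>')) $ i = 0"
      by (simp add: matrix_vector_mult_diff_distrib matrix_vector_mult_scaleR vector_scalar_commute \<theta>(3) \<theta>'(3))
        (simp add: c_def c'_def algebra_simps)
  qed
  then have "c *s \<theta> = c' *s \<theta>'" by simp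
  then have "(c *s \<theta>) $ i = (c' *s \<theta>') $ i" for i by simp
  then have "c * \<theta> $ i = c' * \<theta>' $ i" for i by simp
  then have "c * ?d \<theta> = c' * ?d \<theta>'" by (simp add: right_diff_distrib)
  then have "(1 / t' - 1 / s) = (1 / t - 1 / s)" using \<theta>(2) \<theta>'(2) unfolding c_def c'_def by auto
  then show ?thesis by simp
qed

text \<open>
  The Gram matrix of the map that sends \<open>\<theta>\<close> to the entries of \<open>B \<theta>\<close> outside \<open>A\<close> together with the
  entries of \<open>\<theta>\<close> in \<open>M\<close>.  Its determinant turns \<open>attack_free\<close> into a measurable condition on the
  reactances.
\<close>

definition gram ::
    "('n \<times> 'n) set \<Rightarrow> ('n \<times> 'n \<Rightarrow> real) \<Rightarrow> 'n set \<Rightarrow> 'n::finite set \<Rightarrow> real ^ 'n ^ 'n" where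
  "gram L x M A =
     (\<chi> i j. (\<Sum>k\<in>- A. laplacian L x $ k $ i * laplacian L x $ k $ j) + of_bool (i = j \<and> i \<in> M))"

lemma gram_mult_nth:
  "(gram L x M A *v \<theta>) $ i =
     (\<Sum>k\<in>- A. laplacian L x $ k $ i * (laplacian L x *v \<theta>) $ k) + of_bool (i \<in> M) * \<theta> $ i"
proof -
  have "(gram L x M A *v \<theta>) $ i =
     (\<Sum>j\<in>UNIV. \<Sum>k\<in>- A. laplacian L x $ k $ i * (laplacian L x $ k $ j * \<theta> $ j))
     + (\<Sum>j\<in>UNIV. of_bool (i = j \<and> i \<in> M) * \<theta> $ j)"
    unfolding gram_def matrix_vector_mult_def
    by (simp add: distrib_right sum.distrib sum_distrib_right mult.assoc)
  also have "(\<Sum>j\<in>UNIV. \<Sum>k\<in>- A. laplacian L x $ k $ i * (laplacian L x $ k $ j * \<theta> $ j)) =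
     (\<Sum>k\<in>- A. laplacian L x $ k $ i * (laplacian L x *v \<theta>) $ k)"
    by (subst sum.swap) (simp add: matrix_vector_mult_def sum_distrib_left)
  also have "(\<Sum>j\<in>UNIV. of_bool (i = j \<and> i \<in> M) * \<theta> $ j) = of_bool (i \<in> M) * \<theta> $ i"
    by (subst sum.remove[of _ i]) (auto intro!: sum.neutral)
  finally show ?thesis .
qed

lemma gram_energy:
  "(\<Sum>i\<in>UNIV. \<theta> $ i * (gram L x M A *v \<theta>) $ i) =
     (\<Sum>k\<in>- A. ((laplacian L x *v \<theta>) $ k)\<^sup>2) + (\<Sum>i\<in>M. (\<theta> $ i)\<^sup>2)"
proof -
  have "(\<Sum>i\<in>UNIV. \<theta> $ i * (gram L x M A *v \<theta>) $ i) =
     (\<Sum>i\<in>UNIV. \<Sum>k\<in>- A. (laplacian L x *v \<theta>) $ k * (laplacian L x $ k $ i * \<theta> $ i))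
     + (\<Sum>i\<in>UNIV. of_bool (i \<in> M) * (\<theta> $ i)\<^sup>2)"
    unfolding gram_mult_nth
    by (simp add: distrib_left sum.distrib sum_distrib_left mult_ac power2_eq_square)
  also have "(\<Sum>i\<in>UNIV. \<Sum>k\<in>- A. (laplacian L x *v \<theta>) $ k * (laplacian L x $ k $ i * \<theta> $ i)) =
     (\<Sum>k\<in>- A. ((laplacian L x *v \<theta>) $ k)\<^sup>2)"
    by (subst sum.swap) (simp add: matrix_vector_mult_def sum_distrib_left power2_eq_square)
  also have "(\<Sum>i\<in>UNIV. of_bool (i \<in> M) * (\<theta> $ i)\<^sup>2) = (\<Sum>i\<in>M. (\<theta> $ i)\<^sup>2)"
    by (rule sum.mono_neutral_cong_right) auto
  finally show ?thesis .
qed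

lemma attack_free_iff_det: "attack_free L x M A \<longleftrightarrow> det (gram L x M A) \<noteq> 0"
proof -
  have "(\<forall>i\<in>M. \<theta> $ i = 0) \<and> (\<forall>i. i \<notin> A \<longrightarrow> (laplacian L x *v \<theta>) $ i = 0) \<longleftrightarrow> gram L x M A *v \<theta> = 0" for \<theta>
  proof
    assume "gram L x M A *v \<theta> = 0"
    then have "(\<Sum>k\<in>- A. ((laplacian L x *v \<theta>) $ k)\<^sup>2) + (\<Sum>i\<in>M. (\<theta> $ i)\<^sup>2) = 0"
      unfolding gram_energy[symmetric] by simp
    then have "(\<Sum>k\<in>- A. ((laplacian L x *v \<theta>) $ k)\<^sup>2) = 0" "(\<Sum>i\<in>M. (\<theta> $ i)\<^sup>2) = 0"
      by (simp_all add: add_nonneg_eq_0_iff sum_nonneg)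
    then show "(\<forall>i\<in>M. \<theta> $ i = 0) \<and> (\<forall>i. i \<notin> A \<longrightarrow> (laplacian L x *v \<theta>) $ i = 0)"
      by (simp add: sum_nonneg_eq_0_iff)
  qed (auto simp: vec_eq_iff gram_mult_nth intro!: sum.neutral)
  then have "attack_free L x M A \<longleftrightarrow> (\<forall>\<theta>. gram L x M A *v \<theta> = 0 \<longrightarrow> \<theta> = 0)"
    unfolding attack_free_def by blast
  also have "\<dots> \<longleftrightarrow> det (gram L x M A) \<noteq> 0"
    by (metis invertible_det_nz invertible_left_inverse matrix_left_invertible_ker)
  finally show ?thesis .
qed

lemma measurable_det_gram:
  assumes "\<And>l. l \<in> L \<Longrightarrow> (\<lambda>y. x y l) \<in> borel_measurable N"
  shows "(\<lambda>y. det (gram L (x y) M A)) \<in> borel_measurable N"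
proof -
  have "(\<lambda>y. laplacian L (x y) $ i $ j) \<in> borel_measurable N" for i j
    unfolding laplacian_entry
    by (intro borel_measurable_sum borel_measurable_times borel_measurable_divide
        borel_measurable_const assms)
  then have "(\<lambda>y. gram L (x y) M A $ i $ j) \<in> borel_measurable N" for i j
    unfolding gram_def vec_lambda_beta
    by (intro borel_measurable_add borel_measurable_sum borel_measurable_times borel_measurable_const)
  then show ?thesis
    unfolding det_def
    by (intro borel_measurable_sum borel_measurable_times borel_measurable_prod borel_measurable_const)
qed

section \<open>Generic reactances\<close>

lemma (in product_sigma_finite) AE_PiM_insertI:
  assumes I: "finite I" "i \<notin> I"
    and P: "{y \<in> space (Pi\<^sub>M (insert i I) M). P y} \<in> sets (Pi\<^sub>M (insert i I) M)"
    and AE: "AE y in Pi\<^sub>M I M. AE t in M i. P (y(i := t))"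
  shows "AE y in Pi\<^sub>M (insert i I) M. P y"
proof -
  let ?N = "{y \<in> space (Pi\<^sub>M (insert i I) M). \<not> P y}"
  have "?N = space (Pi\<^sub>M (insert i I) M) - {y \<in> space (Pi\<^sub>M (insert i I) M). P y}" by auto
  then have N: "?N \<in> sets (Pi\<^sub>M (insert i I) M)" using sets.compl_sets[OF P] by simp
  have "emeasure (Pi\<^sub>M (insert i I) M) ?N
      = (\<integral>\<^sup>+ y. (\<integral>\<^sup>+ t. indicator ?N (y(i := t)) \<partial>M i) \<partial>Pi\<^sub>M I M)"
    using N by (subst product_nn_integral_insert[OF I, symmetric]) auto
  also have "\<dots> = (\<integral>\<^sup>+ y. 0 \<partial>Pi\<^sub>M I M)"
  proof (rule nn_integral_cong_AE, use AE in eventually_elim)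
    fix y assume "AE t in M i. P (y(i := t))"
    then have "(\<integral>\<^sup>+ t. indicator ?N (y(i := t)) \<partial>M i) = (\<integral>\<^sup>+ t. 0 \<partial>M i)"
      by (intro nn_integral_cong_AE) (auto simp: indicator_def)
    then show "(\<integral>\<^sup>+ t. indicator ?N (y(i := t)) \<partial>M i) = 0" by simp
  qed
  finally have "emeasure (Pi\<^sub>M (insert i I) M) ?N = 0" by simp
  with N show ?thesis by (intro AE_I[of _ _ ?N]) auto
qed

text \<open>
  Starting from one favourable point \<open>x\<^sub>0\<close>, the coordinates are replaced by random ones one at a time.
  By \<open>attack_free_upd_unique_exception\<close> each replacement fails for at most one value, which an
  atomless distribution does not hit.
\<close>

lemma AE_attack_free_PiM:
  fixes L :: "('n::finite \<times> 'n) set" and \<mu> :: "'n \<times> 'n \<Rightarrow> real measure"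
  assumes \<mu>: "\<And>l. prob_space (\<mu> l)" "\<And>l. sets (\<mu> l) = sets borel"
    and atomless: "\<And>l t. l \<in> L \<Longrightarrow> emeasure (\<mu> l) {t} = 0"
    and free: "attack_free L x\<^sub>0 M A" and "J \<subseteq> L"
  shows "AE y in Pi\<^sub>M J \<mu>. attack_free L (override_on x\<^sub>0 y J) M A"
proof -
  interpret product_prob_space \<mu>
    using \<mu>(1) by (simp add: product_prob_space_def product_prob_space_axioms_def product_sigma_finite_def prob_space_imp_sigma_finite)
  have "finite J" by simp
  then show ?thesis using \<open>J \<subseteq> L\<close>
  proof (induction J rule: finite_induct)
    case empty
    then show ?case using free by simp
  next
    case (insert l J)
    have l: "l \<in> L" using insert by simp
    show ?case
    proof (rule AE_PiM_insertI[OF insert.hyps])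
      have "(\<lambda>y. override_on x\<^sub>0 y (insert l J) k) \<in> borel_measurable (Pi\<^sub>M (insert l J) \<mu>)" for k
      proof (cases "k \<in> insert l J")
        case True
        then have "(\<lambda>y. y k) \<in> measurable (Pi\<^sub>M (insert l J) \<mu>) (\<mu> k)"
          by (rule measurable_component_singleton)
        with True show ?thesis by (simp add: override_on_def measurable_cong_sets[OF refl \<mu>(2)])
      qed (simp add: override_on_def)
      then have "(\<lambda>y. det (gram L (override_on x\<^sub>0 y (insert l J)) M A)) \<in> borel_measurable (Pi\<^sub>M (insert l J) \<mu>)"
        by (intro measurable_det_gram)
      then show "{y \<in> space (Pi\<^sub>M (insert l J) \<mu>). attack_free L (override_on x\<^sub>0 y (insert l J)) M A}
          \<in> sets (Pi\<^sub>M (insert l J) \<mu>)"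
        unfolding attack_free_iff_det by measurable
    next
      have "AE y in Pi\<^sub>M J \<mu>. attack_free L (override_on x\<^sub>0 y J) M A"
        using insert by simp
      then show "AE y in Pi\<^sub>M J \<mu>. AE t in \<mu> l. attack_free L (override_on x\<^sub>0 (y(l := t)) (insert l J)) M A"
      proof eventually_elim
        fix y assume y: "attack_free L (override_on x\<^sub>0 y J) M A"
        let ?z = "override_on x\<^sub>0 y J"
        have upd: "override_on x\<^sub>0 (y(l := t)) (insert l J) = ?z(l := t)" for t
          using insert.hyps by (auto simp: override_on_def fun_eq_iff)
        \<comment> \<open>The old value of the coordinate serves as the favourable value that the uniqueness lemma needs.\<close>
        have "attack_free L (?z(l := ?z l)) M A" using y by simp
        note unique = attack_free_upd_unique_exception[OF l this]
        obtain r where r: "\<And>t. t \<noteq> r \<Longrightarrow> attack_free L (?z(l := t)) M A"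
          using unique by metis
        have "{r} \<in> sets (\<mu> l)" using \<mu>(2) by simp
        with r show "AE t in \<mu> l. attack_free L (override_on x\<^sub>0 (y(l := t)) (insert l J)) M A"
          unfolding upd using atomless[OF l, of r] by (intro AE_I[of _ _ "{r}"]) auto
      qed
    qed
  qed
qed

lemma attack_free_cong:
  assumes "\<And>l. l \<in> L \<Longrightarrow> x l = y l"
  shows "attack_free L x M A = attack_free L y M A"
proof -
  have "laplacian L x = laplacian L y" unfolding laplacian_def using assms by simp
  then show ?thesis unfolding attack_free_def by simp
qed

lemma continuous_rv_atomless:
  assumes "prob_space P" and X: "continuous_rv P X"
  shows "emeasure (distr P borel X) {t} = 0"
proof -
  interpret prob_space P by fact
  have m: "X \<in> borel_measurable P" using X by (simp add: continuous_rv_def)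
  interpret D: real_distribution "distr P borel X"
    using m by (rule real_distribution_distr)
  have "isCont (cdf (distr P borel X)) t"
    using X by (simp add: continuous_rv_def continuous_on_eq_continuous_at)
  then show ?thesis using D.isCont_cdf D.emeasure_eq_measure by simp
qed

lemma AE_attack_free:
  fixes L :: "('n::finite \<times> 'n) set" and x :: "'n \<times> 'n \<Rightarrow> 'a \<Rightarrow> real"
  assumes P: "prob_space P" and indep: "prob_space.indep_vars P (\<lambda>_. borel) x L"
    and cont: "\<And>l. l \<in> L \<Longrightarrow> continuous_rv P (x l)"
    and free: "attack_free L x\<^sub>0 M A"
  shows "AE \<omega> in P. attack_free L (\<lambda>l. x l \<omega>) M A"
proof (cases "L = {}")
  case True
  then have "attack_free L (\<lambda>l. x l \<omega>) M A" for \<omega>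
    using free attack_free_cong[of L x\<^sub>0] by blast
  then show ?thesis by simp
next
  case False
  interpret prob_space P by fact
  have rv: "x l \<in> borel_measurable P" if "l \<in> L" for l
    using cont[OF that] by (simp add: continuous_rv_def)
  \<comment> \<open>Off \<open>L\<close> a point mass is put in, so that \<open>\<mu>\<close> is a probability measure at every index.\<close>
  define \<mu> where "\<mu> l = distr P borel (if l \<in> L then x l else (\<lambda>_. 0))" for l
  have \<mu>: "prob_space (\<mu> l)" "sets (\<mu> l) = sets borel" for l
    unfolding \<mu>_def by (intro prob_space_distr, use rv[of l] in simp) simp
  let ?X = "\<lambda>\<omega>. \<lambda>l\<in>L. x l \<omega>"
  have "distr P (\<Pi>\<^sub>M l\<in>L. borel) ?X = (\<Pi>\<^sub>M l\<in>L. distr P borel (x l))"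
    using indep_vars_iff_distr_eq_PiM'[where X = x and M' = "\<lambda>_. borel", OF False rv] indep by simp
  also have "\<dots> = Pi\<^sub>M L \<mu>" by (intro PiM_cong) (auto simp: \<mu>_def)
  finally have dist: "distr P (\<Pi>\<^sub>M l\<in>L. borel) ?X = Pi\<^sub>M L \<mu>" .
  have "AE y in Pi\<^sub>M L \<mu>. attack_free L (override_on x\<^sub>0 y L) M A"
    by (rule AE_attack_free_PiM[OF \<mu> _ free])
      (simp_all add: \<mu>_def continuous_rv_atomless[OF P cont])
  then have "AE \<omega> in P. attack_free L (override_on x\<^sub>0 (?X \<omega>) L) M A"
    unfolding dist[symmetric] by (rule AE_distrD[rotated]) (intro measurable_restrict rv)
  moreover have "attack_free L (override_on x\<^sub>0 (?X \<omega>) L) M A = attack_free L (\<lambda>l. x l \<omega>) M A" for \<omega>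
    by (rule attack_free_cong) simp
  ultimately show ?thesis by simp
qed

section \<open>Vulnerable cuts admit sparse attacks\<close>

lemma kernel_vector_coordinate_subspaces:
  fixes B :: "real ^ 'n ^ 'n::finite"
  assumes "card T < card S"
  obtains \<theta> where "\<theta> \<noteq> 0" and "\<And>i. i \<notin> S \<Longrightarrow> \<theta> $ i = 0" and "\<And>i. i \<in> T \<Longrightarrow> (B *v \<theta>) $ i = 0"
proof -
  let ?V = "\<lambda>S. {v :: real ^ 'n. \<forall>i. i \<notin> S \<longrightarrow> v $ i = 0}"
  define f where "f \<theta> = (\<chi> i. if i \<in> T then (B *v \<theta>) $ i else 0)" for \<theta>
  have lin: "linear f"
    by (rule linearI) (auto simp: f_def vec_eq_iff matrix_vector_right_distrib matrix_vector_mult_scaleR)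
  have sub: "subspace (?V S)" for S
    by (auto simp: subspace_def)
  have dimV: "dim (?V S) = card S" for S :: "'n set"
    using dim_substandard_cart[of S, where 'a = real] by (simp add: dim_vec_eq)
  have "\<not> inj_on f (?V S)"
  proof
    assume "inj_on f (?V S)"
    then have "dim (f ` ?V S) = dim (?V S)"
      using lin sub[of S] by (intro dim_image_eq) (simp_all only: iffD2[OF span_eq_iff])
    moreover have "dim (f ` ?V S) \<le> dim (?V T)"
      by (rule dim_subset) (auto simp: f_def)
    ultimately show False using assms unfolding dimV by simp
  qed
  then obtain u v where uv: "u \<in> ?V S" "v \<in> ?V S" "f u = f v" "u \<noteq> v"
    unfolding inj_on_def by blast
  have "f (u - v) = 0" using uv(3) lin by (simp add: linear_diff)
  then have "(B *v (u - v)) $ i = 0" if "i \<in> T" for i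
    using that by (auto simp: f_def vec_eq_iff dest: spec[of _ i])
  with uv that[of "u - v"] show ?thesis by auto
qed

text \<open>
  A dimension count that is valid for all reactances.  An attack supported in the cut-off set \<open>S\<close> has
  injections only in \<open>S\<close> and in the part \<open>D\<close> of the cut that lies inside the grid (the cut may also
  contain the dummy bus).  By vulnerability \<open>S \<union> D\<close> contains a set \<open>A\<close> of \<open>card D + 1\<close> alterable buses.
  Requiring zero injection at the other buses of \<open>S \<union> D\<close> imposes \<open>card S - 1\<close> linear conditions on
  \<open>card S\<close> unknowns.
\<close>

lemma min_sparsity_le_vulnerable_cut:
  fixes L :: "('n::finite \<times> 'n) set"
  assumes C: "vulnerable_vertex_cut L M U C"
  shows "min_sparsity L x M U \<le> enat (card C + 1)"
proof -
  define D where "D = {v. Some v \<in> C}"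
  define S where "S = {v. v \<notin> D \<and> (\<forall>m\<in>M - D. (v, m) \<notin> (Restr (L \<union> L\<inverse>) (- D))\<^sup>*)}"
  have D_le: "card D \<le> card C"
    using card_mono[of C "Some ` D"] unfolding D_def by (auto simp: card_image)
  have lift: "(Some u, Some v) \<in> (Restr (augmented_edges L M) (- C))\<^sup>*"
    if "(u, v) \<in> (Restr (L \<union> L\<inverse>) (- D))\<^sup>*" for u v
    using that
  proof induction
    case (step v w)
    then have "(Some v, Some w) \<in> Restr (augmented_edges L M) (- C)"
      unfolding augmented_edges_def D_def by auto
    with step show ?case by (meson rtrancl.rtrancl_into_rtrancl)
  qed simp
  have cut: "v \<in> S" if "Some v \<in> cut_off L M C" for v
    using that lift unfolding S_def cut_off_def D_def augmented_set_def by blast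
  let ?N = "- U \<inter> (S \<union> D)"
  have "card C + 1 \<le> card (Some ` (- U) \<inter> (cut_off L M C \<union> C))"
    using C unfolding vulnerable_vertex_cut_def by simp
  also have "\<dots> \<le> card (Some ` ?N)"
    using cut unfolding D_def by (intro card_mono) auto
  also have "\<dots> = card ?N" by (simp add: card_image)
  finally have "card D + 1 \<le> card ?N" using D_le by simp
  then obtain A where A: "A \<subseteq> ?N" "card A = card D + 1"
    by (metis obtain_subset_with_card_n)
  have "card ((S \<union> D) - A) = card (S \<union> D) - card A"
    using A by (intro card_Diff_subset) auto
  moreover have "card (S \<union> D) = card S + card D"
    by (rule card_Un_disjoint) (auto simp: S_def)
  moreover have "card A \<le> card (S \<union> D)" using A by (intro card_mono) auto
  ultimately have "card ((S \<union> D) - A) < card S" using A(2) by simp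
  then obtain \<theta> :: "real ^ 'n" where \<theta>: "\<theta> \<noteq> 0" "\<And>i. i \<notin> S \<Longrightarrow> \<theta> $ i = 0"
    "\<And>i. i \<in> (S \<union> D) - A \<Longrightarrow> (laplacian L x *v \<theta>) $ i = 0"
    by (rule kernel_vector_coordinate_subspaces[where B = "laplacian L x"]) blast
  have closed: "j \<in> S \<union> D" if "i \<in> S" "(i, j) \<in> L \<union> L\<inverse>" for i j
  proof (rule ccontr)
    assume j: "j \<notin> S \<union> D"
    then obtain m where m: "m \<in> M - D" "(j, m) \<in> (Restr (L \<union> L\<inverse>) (- D))\<^sup>*"
      unfolding S_def by blast
    have "(i, j) \<in> Restr (L \<union> L\<inverse>) (- D)" using that j unfolding S_def by blast
    then have "(i, m) \<in> (Restr (L \<union> L\<inverse>) (- D))\<^sup>*" using m(2) by (rule converse_rtrancl_into_rtrancl)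
    with m(1) \<open>i \<in> S\<close> show False unfolding S_def by blast
  qed
  have supp: "(laplacian L x *v \<theta>) $ i = 0" if "i \<notin> A" for i
  proof (cases "i \<in> S \<union> D")
    case False
    have "(\<theta> $ fst l - \<theta> $ snd l) * incidence_vector l $ i = 0" if "l \<in> L" for l
    proof (cases "i = fst l \<or> i = snd l")
      case True
      then have "fst l \<notin> S" "snd l \<notin> S"
        using False that closed[of "fst l" "snd l"] closed[of "snd l" "fst l"] by auto
      then show ?thesis using \<theta>(2) by simp
    qed (simp add: incidence_vector_nth)
    then show ?thesis unfolding laplacian_mult_nth by (auto intro!: sum.neutral)
  qed (use \<theta>(3) that in blast)
  have "enat (l0_norm (laplacian L x *v \<theta>)) \<in> {enat (l0_norm \<Delta>P) | \<Delta>P \<Delta>\<theta>.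
            \<Delta>P = laplacian L x *v \<Delta>\<theta> \<and> (\<forall>i\<in>M. \<Delta>\<theta> $ i = 0) \<and>
            (\<forall>i\<in>U. \<Delta>P $ i = 0) \<and> \<Delta>\<theta> \<noteq> 0}"
  proof -
    have "\<forall>i\<in>M. \<theta> $ i = 0" using \<theta>(2) unfolding S_def by blast
    moreover have "\<forall>i\<in>U. (laplacian L x *v \<theta>) $ i = 0" using supp A(1) by blast
    ultimately show ?thesis using \<theta>(1) by blast
  qed
  then have "min_sparsity L x M U \<le> enat (l0_norm (laplacian L x *v \<theta>))"
    unfolding min_sparsity_def by (rule Inf_lower)
  also have "l0_norm (laplacian L x *v \<theta>) \<le> card A"
    unfolding l0_norm_def using supp by (intro card_mono) auto
  then have "enat (l0_norm (laplacian L x *v \<theta>)) \<le> enat (card C + 1)"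
    using A(2) D_le by simp
  finally show ?thesis .
qed

section \<open>Small separators are vulnerable cuts\<close>

lemma connected_augmented:
  assumes conn: "connected_graph UNIV (L \<union> L\<inverse>)" and "M \<noteq> {}"
  shows "connected_graph UNIV (augmented_edges L M)"
proof -
  let ?E = "augmented_edges L M"
  have Some: "(Some u, Some v) \<in> ?E\<^sup>*" for u v
  proof -
    have "(u, v) \<in> (L \<union> L\<inverse>)\<^sup>*" using conn unfolding connected_graph_def by simp
    then show ?thesis
    proof induction
      case (step v w)
      then have "(Some v, Some w) \<in> ?E" unfolding augmented_edges_def by auto
      with step show ?case by (meson rtrancl.rtrancl_into_rtrancl)
    qed simp
  qed
  obtain m where "m \<in> M" using \<open>M \<noteq> {}\<close> by blast
  then have "(None, Some m) \<in> ?E" "(Some m, None) \<in> ?E"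
    unfolding augmented_edges_def augmented_set_def by auto
  then have "(None, Some v) \<in> ?E\<^sup>*" "(Some v, None) \<in> ?E\<^sup>*" for v
    using Some[of m v] Some[of v m]
    by (auto intro: converse_rtrancl_into_rtrancl rtrancl.rtrancl_into_rtrancl)
  then have "(u, v) \<in> ?E\<^sup>*" for u v
    using Some by (cases u; cases v) auto
  then show ?thesis unfolding connected_graph_def by simp
qed

text \<open>
  Every bus of \<open>A\<close> lies in the cut or is cut off by it: a walk in the augmented graph that starts in
  \<open>A - C\<close> and avoids \<open>C\<close> would have to reach a bus of \<open>M\<close> before it could use an edge of the clique
  on \<open>M\<close> and the dummy bus.
\<close>

lemma small_separator_is_vulnerable_cut:
  fixes L :: "('n::finite \<times> 'n) set"
  assumes conn: "connected_graph UNIV (L \<union> L\<inverse>)" and "M \<noteq> {}"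
    and sep: "separates (L \<union> L\<inverse>) A M C" and card: "card C < card A" and AU: "A \<inter> U = {}"
  shows "vulnerable_vertex_cut L M U (Some ` C)"
proof -
  let ?E = "Restr (augmented_edges L M) (- Some ` C)"
  have off: "Some a \<in> cut_off L M (Some ` C)" if a: "a \<in> A - C" for a
  proof -
    let ?K = "{Some v | v. (a, v) \<in> (Restr (L \<union> L\<inverse>) (- C))\<^sup>*}"
    have K: "b \<in> ?K" if "(Some a, b) \<in> ?E\<^sup>*" for b
    proof (rule rtrancl_closed[OF that])
      fix u w assume uw: "(u, w) \<in> ?E" "u \<in> ?K"
      then obtain v where v: "u = Some v" "(a, v) \<in> (Restr (L \<union> L\<inverse>) (- C))\<^sup>*" by blast
      have "v \<notin> M" using sep a v uw(1) unfolding separates_def by auto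
      then obtain v' where v': "w = Some v'" "(v, v') \<in> Restr (L \<union> L\<inverse>) (- C)"
        using uw(1) v(1) unfolding augmented_edges_def augmented_set_def by auto
      with v show "w \<in> ?K" by (auto intro: rtrancl.rtrancl_into_rtrancl)
    qed simp
    have "(Some a, b) \<notin> ?E\<^sup>*" if "b \<in> augmented_set M - Some ` C" for b
      using K[of b] that sep a unfolding separates_def augmented_set_def by auto
    then show ?thesis using a unfolding cut_off_def by auto
  qed
  have "\<not> A \<subseteq> C" using card card_mono[of C A] by auto
  then obtain a where "a \<in> A - C" by blast
  from off[OF this] have a: "Some a \<notin> Some ` C" "(Some a, None) \<notin> ?E\<^sup>*"
    unfolding cut_off_def augmented_set_def by auto
  moreover have "- Some ` C = UNIV - Some ` C" by auto
  ultimately have "\<not> connected_graph (UNIV - Some ` C) (augmented_edges L M)"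
    unfolding connected_graph_def by auto
  then have "vertex_cut UNIV (augmented_edges L M) (Some ` C)"
    using connected_augmented[OF conn \<open>M \<noteq> {}\<close>] unfolding vertex_cut_def by simp
  moreover have "card (Some ` A) \<le> card (Some ` (- U) \<inter> (cut_off L M (Some ` C) \<union> Some ` C))"
    using off AU by (intro card_mono) auto
  ultimately show ?thesis
    using card unfolding vulnerable_vertex_cut_def by (simp add: card_image)
qed

section \<open>The minimum sparsity of attacks\<close>

lemma linked_imp_AE_attack_free:
  fixes L :: "('n::finite \<times> 'n) set" and x :: "'n \<times> 'n \<Rightarrow> 'a \<Rightarrow> real"
  assumes "prob_space P" and "prob_space.indep_vars P (\<lambda>_. borel) x L"
    and "\<And>l. l \<in> L \<Longrightarrow> continuous_rv P (x l)"
    and conn: "connected_graph UNIV (L \<union> L\<inverse>)" and "M \<noteq> {}"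
    and p: "linkage (L \<union> L\<inverse>) A M p"
  shows "AE \<omega> in P. attack_free L (\<lambda>l. x l \<omega>) M A"
proof -
  obtain F where "F \<subseteq> L"
    and "\<And>a a'. a \<in> A \<Longrightarrow> a' \<in> A \<Longrightarrow> (a, a') \<in> (F \<union> F\<inverse>)\<^sup>* \<Longrightarrow> a = a'"
    and "\<And>v. \<exists>m\<in>M. (v, m) \<in> (F \<union> F\<inverse>)\<^sup>*"
    using linkage_extends_to_spanning_subgraph[OF conn p \<open>M \<noteq> {}\<close>] by metis
  then have "attack_free L (indicator F) M A"
    by (rule attack_free_spanning_subgraph)
  with assms(1-3) show ?thesis by (rule AE_attack_free)
qed

theorem theorem2:
  fixes P :: "'a measure"
    and L :: "('n::finite \<times> 'n) set"
    and x :: "'n \<times> 'n \<Rightarrow> 'a \<Rightarrow> real"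
    and M U :: "'n set"
  assumes "prob_space P"
    and "connected_grid L"
    and "prob_space.indep_vars P (\<lambda>_. borel) x L"
    and "\<And>l. l \<in> L \<Longrightarrow> continuous_rv P (x l)"
    and "\<And>l. l \<in> L \<Longrightarrow> \<exists>c>0. AE \<omega> in P. c \<le> x l \<omega>"
    and "M \<noteq> {}"
  shows "AE \<omega> in P. min_sparsity L (\<lambda>l. x l \<omega>) M U = vulnerable_connectivity L M U + 1"
proof -
  let ?linked = "{A. \<exists>p. linkage (L \<union> L\<inverse>) A M p}"
  have conn: "connected_graph UNIV (L \<union> L\<inverse>)"
    using assms(2) unfolding connected_grid_def by blast
  have "AE \<omega> in P. \<forall>A\<in>?linked. attack_free L (\<lambda>l. x l \<omega>) M A"
    using linked_imp_AE_attack_free[OF assms(1,3,4) conn assms(6)]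
    by (intro AE_finite_allI) auto
  then show ?thesis
  proof eventually_elim
    fix \<omega> assume generic: "\<forall>A\<in>?linked. attack_free L (\<lambda>l. x l \<omega>) M A"
    let ?x = "\<lambda>l. x l \<omega>"
    show "min_sparsity L ?x M U = vulnerable_connectivity L M U + 1"
    proof (rule antisym)
      show "min_sparsity L ?x M U \<le> vulnerable_connectivity L M U + 1"
      proof (cases "\<exists>C. vulnerable_vertex_cut L M U C")
        case True
        then have "vulnerable_connectivity L M U \<in> {enat (card C) | C. vulnerable_vertex_cut L M U C}"
          unfolding vulnerable_connectivity_def Inf_enat_def by (auto intro: LeastI2)
        then obtain C where "vulnerable_vertex_cut L M U C" "vulnerable_connectivity L M U = enat (card C)"
          by blast
        then show ?thesis using min_sparsity_le_vulnerable_cut[of L M U C ?x]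
          by (simp add: one_enat_def)
      qed (simp add: vulnerable_connectivity_def Inf_enat_def)
    next
      show "vulnerable_connectivity L M U + 1 \<le> min_sparsity L ?x M U"
        unfolding min_sparsity_def
      proof (rule Inf_greatest, elim CollectE exE conjE)
        fix e \<Delta>P and \<Delta>\<theta> :: "real ^ 'n"
        assume e: "e = enat (l0_norm \<Delta>P)" and \<Delta>P: "\<Delta>P = laplacian L ?x *v \<Delta>\<theta>"
          and M: "\<forall>i\<in>M. \<Delta>\<theta> $ i = 0" and U: "\<forall>i\<in>U. \<Delta>P $ i = 0" and "\<Delta>\<theta> \<noteq> 0"
        \<comment> \<open>The attack itself shows that its buses cannot be linked into \<open>M\<close>, so Menger's theorem yields a cut.\<close>
        define A where "A = {i. \<Delta>P $ i \<noteq> 0}"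
        have "\<not> attack_free L ?x M A"
          using M \<open>\<Delta>\<theta> \<noteq> 0\<close> unfolding attack_free_def A_def \<Delta>P by blast
        then have "\<not> (\<exists>p. linkage (L \<union> L\<inverse>) A M p)" using generic by blast
        then obtain C where C: "separates (L \<union> L\<inverse>) A M C" "card C < card A"
          using menger[of "L \<union> L\<inverse>" A M] by force
        have "vulnerable_vertex_cut L M U (Some ` C)"
          using conn assms(6) C by (rule small_separator_is_vulnerable_cut) (use U in \<open>auto simp: A_def\<close>)
        then have "vulnerable_connectivity L M U \<le> enat (card C)"
          unfolding vulnerable_connectivity_def
          by (intro Inf_lower) (auto simp: card_image intro!: exI[of _ "Some ` C"])
        then have "vulnerable_connectivity L M U + 1 \<le> enat (card C) + 1"
          by (rule add_right_mono)
        also have "\<dots> \<le> e"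
          using C(2) unfolding e l0_norm_def A_def by (simp add: one_enat_def)
        finally show "vulnerable_connectivity L M U + 1 \<le> e" .
      qed
    qed
  qed
qed

end
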